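(* Let $G$ be a finitely generated group, $A$ a finite alphabet and $L\subset A_G^*$ a $G$-recursively enumerable set of patterns. Then there exists a set $\mathcal C$ of pattern codings over $A$ that is recursively enumerable with oracle $\mathtt{WP}(G)$ and satisfies $L=p(\mathcal C)$.
   Context: Let $S\subset G$ be a finite generating set closed under inverses and containing $1_G$. Words in $S^*$ represent elements of $G$; write $u=_G v$ if they represent the same element. $\mathtt{WP}(G)=\{w\in S^*: w=_G 1_G\}$. A pattern over a finite alphabet $A$ is an element of $A^F$ with $F\subset G$ finite; $A_G^*$ is the set of all patterns. A pattern coding over $A$ is a finite set $c$ of pairs $(w,a)$ with $w\in S^*$, $a\in A$. It is consistent if $(u,a),(v,b)\in c$ and $u=_G v$ imply $a=b$; then $p(c)$ is the pattern whose support is the set of group elements represented by the words in $c$, with $p(c)_w=a$ for $(w,a)\in c$. For a set $\mathcal C$ of pattern codings, $p(\mathcal C)=\{p(c): c\in\mathcal C \text{ consistent}\}$. $\mathcal C$ is recursively enumerable with oracle $\mathtt{WP}(G)$ if some Turing machine with oracle $\mathtt{WP}(G)$ accepts exactly the inputs $c\in\mathcal C$. A $G$-machine is a tuple $(Q,\Sigma,\sqcup,q_0,Q_F,\delta)$ with $Q$ a finite set of states, $\Sigma$ a finite tape alphabet, $\sqcup\in\Sigma$ the blank symbol, $q_0\in Q$ the initial state, $Q_F\subset Q$ the accepting states, and $\delta:\Sigma\times Q\to\Sigma\times Q\times S$. It acts on $\Sigma^G\times Q$ by: if $\delta(x_{1_G},q)=(a,q',s)$ then $T(x,q)=(\sigma_{s^{-1}}(\widetilde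 x),q')$, where $\widetilde x_{1_G}=a$, $\widetilde x$ equals $x$ elsewhere, and $(\sigma_g y)_h=y_{g^{-1}h}$. For a pattern $p\in\Sigma^F$, $x^p\in\Sigma^G$ equals $p$ on $F$ and $\sqcup$ off $F$; $T$ accepts $p$ if $T^n(x^p,q_0)\in\Sigma^G\times Q_F$ for some $n\in\mathbb N$. A set $L\subset A_G^*$ is $G$-recursively enumerable if there is a $G$-machine whose tape alphabet $\Sigma$ contains $A$ and which, for every $p\in A_G^*$, accepts $p$ if and only if $p\in L$. *)

theory Defs
  imports "HOL-Algebra.Generated_Groups"
begin

section \<open>Words over a generating set and the word problem\<close>

definition word_value :: "('g, 'b) monoid_scheme \<Rightarrow> 'g list \<Rightarrow> 'g" where
  "word_value G w = foldr (mult G) w (one G)"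

definition word_problem :: "('g, 'b) monoid_scheme \<Rightarrow> 'g set \<Rightarrow> 'g list set" where
  "word_problem G S = {w \<in> lists S. word_value G w = one G}"


section \<open>Patterns and pattern codings\<close>

text \<open>A pattern with support \<open>F\<close> is a partial map with domain \<open>F\<close>.\<close>

definition patterns :: "('g, 'b) monoid_scheme \<Rightarrow> 'a set \<Rightarrow> ('g \<rightharpoonup> 'a) set" where
  "patterns G A = {p. finite (dom p) \<and> dom p \<subseteq> carrier G \<and> ran p \<subseteq> A}"

definition pattern_codings :: "'g set \<Rightarrow> 'a set \<Rightarrow> ('g list \<times> 'a) set set" where
  "pattern_codings S A = {c. finite c \<and> c \<subseteq> lists S \<times> A}"

definition consistent :: "('g, 'b) monoid_scheme \<Rightarrow> ('g list \<times> 'a) set \<Rightarrow> bool" where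
  "consistent G c \<longleftrightarrow>
     (\<forall>u a v b. (u, a) \<in> c \<longrightarrow> (v, b) \<in> c \<longrightarrow> word_value G u = word_value G v \<longrightarrow> a = b)"

text \<open>The description operator is only meaningful for consistent codings.\<close>

definition coded_pattern ::
    "('g, 'b) monoid_scheme \<Rightarrow> ('g list \<times> 'a) set \<Rightarrow> ('g \<rightharpoonup> 'a)" where
  "coded_pattern G c = (\<lambda>g.
     if \<exists>w a. (w, a) \<in> c \<and> word_value G w = g
     then Some (THE a. \<exists>w. (w, a) \<in> c \<and> word_value G w = g)
     else None)"

definition coded_patterns ::
    "('g, 'b) monoid_scheme \<Rightarrow> ('g list \<times> 'a) set set \<Rightarrow> ('g \<rightharpoonup> 'a) set" where
  "coded_patterns G C = {coded_pattern G c |c. c \<in> C \<and> consistent G c}"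


section \<open>Group machines\<close>

record ('g, 's, 'q) g_machine =
  gm_states :: "'q set"
  gm_alphabet :: "'s set"
  gm_blank :: 's
  gm_init :: 'q
  gm_accepting :: "'q set"
  gm_delta :: "'s \<Rightarrow> 'q \<Rightarrow> 's \<times> 'q \<times> 'g"

definition is_g_machine :: "'g set \<Rightarrow> ('g, 's, 'q) g_machine \<Rightarrow> bool" where
  "is_g_machine S M \<longleftrightarrow>
     finite (gm_states M) \<and> finite (gm_alphabet M) \<and>
     gm_blank M \<in> gm_alphabet M \<and> gm_init M \<in> gm_states M \<and>
     gm_accepting M \<subseteq> gm_states M \<and>
     (\<forall>a \<in> gm_alphabet M. \<forall>q \<in> gm_states M.
        gm_delta M a q \<in> gm_alphabet M \<times> gm_states M \<times> S)"

definition shift :: "('g, 'b) monoid_scheme \<Rightarrow> 'g \<Rightarrow> ('g \<Rightarrow> 's) \<Rightarrow> 'g \<Rightarrow> 's" where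
  "shift G g y = (\<lambda>h \<in> carrier G. y (inv\<^bsub>G\<^esub> g \<otimes>\<^bsub>G\<^esub> h))"

fun gm_step ::
    "('g, 'b) monoid_scheme \<Rightarrow> ('g, 's, 'q) g_machine \<Rightarrow> ('g \<Rightarrow> 's) \<times> 'q \<Rightarrow> ('g \<Rightarrow> 's) \<times> 'q" where
  "gm_step G M (x, q) =
     (case gm_delta M (x \<one>\<^bsub>G\<^esub>) q of
        (a, q', s) \<Rightarrow> (shift G (inv\<^bsub>G\<^esub> s) (x(\<one>\<^bsub>G\<^esub> := a)), q'))"

definition gm_fill ::
    "('g, 'b) monoid_scheme \<Rightarrow> ('g, 's, 'q) g_machine \<Rightarrow> ('g \<rightharpoonup> 's) \<Rightarrow> 'g \<Rightarrow> 's" where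
  "gm_fill G M p = (\<lambda>h \<in> carrier G. case p h of Some a \<Rightarrow> a | None \<Rightarrow> gm_blank M)"

definition gm_accepts ::
    "('g, 'b) monoid_scheme \<Rightarrow> ('g, 's, 'q) g_machine \<Rightarrow> ('g \<rightharpoonup> 's) \<Rightarrow> bool" where
  "gm_accepts G M p \<longleftrightarrow>
     (\<exists>n. snd ((gm_step G M ^^ n) (gm_fill G M p, gm_init M)) \<in> gm_accepting M)"

text \<open>
  Up to renaming, every finite state set is a finite set of natural numbers, and every finite tape
  alphabet containing \<open>A\<close> is a finite subset of the type \<open>'a + nat\<close> containing \<open>Inl ` A\<close>.
  As in the definition of the machines, the blank symbol is allowed to be a letter of \<open>A\<close>.
\<close>

definition g_recursively_enumerable ::
    "('g, 'b) monoid_scheme \<Rightarrow> 'g set \<Rightarrow> 'a set \<Rightarrow> ('g \<rightharpoonup> 'a) set \<Rightarrow> bool" where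
  "g_recursively_enumerable G S A L \<longleftrightarrow>
     L \<subseteq> patterns G A \<and>
     (\<exists>M :: ('g, 'a + nat, nat) g_machine.
        is_g_machine S M \<and> Inl ` A \<subseteq> gm_alphabet M \<and>
        (\<forall>p \<in> patterns G A. gm_accepts G M (map_option Inl \<circ> p) \<longleftrightarrow> p \<in> L))"


section \<open>Oracle Turing machines\<close>

text \<open>
  Deterministic Turing machines with finitely many two-way infinite tapes. Tape \<open>0\<close> holds the
  input and tape \<open>1\<close> is the oracle tape. Tape symbols are the blank, input letters, and
  auxiliary symbols.
\<close>

datatype 'i tape_symbol = Blank | Letter 'i | Aux nat

datatype move = Move_Left | Stay | Move_Right

fun move_head :: "move \<Rightarrow> int \<Rightarrow> int" where
  "move_head Move_Left h = h - 1"
| "move_head Stay h = h"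
| "move_head Move_Right h = h + 1"

record 'i oracle_tm =
  tm_tapes :: nat
  tm_states :: "nat set"
  tm_alphabet :: "'i tape_symbol set"
  tm_init :: nat
  tm_accepting :: "nat set"
  tm_query :: nat
  tm_yes :: nat
  tm_no :: nat
  tm_delta :: "nat \<Rightarrow> 'i tape_symbol list \<Rightarrow> nat \<times> 'i tape_symbol list \<times> move list"

definition is_oracle_tm :: "'i set \<Rightarrow> 'i oracle_tm \<Rightarrow> bool" where
  "is_oracle_tm I M \<longleftrightarrow>
     2 \<le> tm_tapes M \<and>
     finite (tm_states M) \<and> finite (tm_alphabet M) \<and>
     Blank \<in> tm_alphabet M \<and> Letter ` I \<subseteq> tm_alphabet M \<and>
     tm_init M \<in> tm_states M \<and> tm_accepting M \<subseteq> tm_states M \<and>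
     tm_query M \<in> tm_states M \<and> tm_yes M \<in> tm_states M \<and> tm_no M \<in> tm_states M \<and>
     (\<forall>q \<in> tm_states M. \<forall>as \<in> lists (tm_alphabet M). length as = tm_tapes M \<longrightarrow>
        (case tm_delta M q as of
           (q', bs, ds) \<Rightarrow> q' \<in> tm_states M \<and> bs \<in> lists (tm_alphabet M) \<and>
             length bs = tm_tapes M \<and> length ds = tm_tapes M))"

text \<open>A tape is its content together with the position of its head.\<close>

type_synonym 'i tape = "(int \<Rightarrow> 'i tape_symbol) \<times> int"

definition word_content :: "'i list \<Rightarrow> int \<Rightarrow> 'i tape_symbol" where
  "word_content w = (\<lambda>i. if 0 \<le> i \<and> i < int (length w) then Letter (w ! nat i) else Blank)"

definition tm_start :: "'i oracle_tm \<Rightarrow> 'i list \<Rightarrow> nat \<times> 'i tape list" where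
  "tm_start M w =
     (tm_init M, (word_content w, 0) # replicate (tm_tapes M - 1) (word_content [], 0))"

text \<open>
  In the query state the machine moves, in one step and without changing its tapes, to the yes
  state if the oracle tape holds exactly a word of the oracle, written from cell \<open>0\<close> on with all
  other cells blank, and to the no state otherwise.
\<close>

fun tm_step :: "'i list set \<Rightarrow> 'i oracle_tm \<Rightarrow> nat \<times> 'i tape list \<Rightarrow> nat \<times> 'i tape list" where
  "tm_step X M (q, ts) =
     (if q = tm_query M
      then (if fst (ts ! 1) \<in> word_content ` X then tm_yes M else tm_no M, ts)
      else (case tm_delta M q (map (\<lambda>(t, h). t h) ts) of
              (q', bs, ds) \<Rightarrow>
                (q', map (\<lambda>((t, h), b, d). (t(h := b), move_head d h)) (zip ts (zip bs ds)))))"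

definition tm_accepts :: "'i list set \<Rightarrow> 'i oracle_tm \<Rightarrow> 'i list \<Rightarrow> bool" where
  "tm_accepts X M w \<longleftrightarrow> (\<exists>n. fst ((tm_step X M ^^ n) (tm_start M w)) \<in> tm_accepting M)"

definition recursively_enumerable_in ::
    "'i list set \<Rightarrow> 'i set \<Rightarrow> 'i list set \<Rightarrow> bool" where
  "recursively_enumerable_in X I K \<longleftrightarrow>
     (\<exists>M. is_oracle_tm I M \<and> {w \<in> lists I. tm_accepts X M w} = K)"


section \<open>Pattern codings as inputs of oracle Turing machines\<close>

text \<open>
  A pattern coding is presented to a machine by listing its pairs. The pair \<open>(w, a)\<close> is written as
  the word \<open>w\<close> followed by the letter \<open>a\<close>; the two alphabets are kept disjoint, so the letters
  also serve as separators. A finite set has many listings (in any order, possibly with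
  repetitions), and a machine accepting exactly the members of \<open>C\<close> has to accept all listings of
  them and no other input.
\<close>

definition encode_listing :: "('g list \<times> 'a) list \<Rightarrow> ('g + 'a) list" where
  "encode_listing cs = concat (map (\<lambda>(w, a). map Inl w @ [Inr a]) cs)"

definition codings_re_with_oracle_WP ::
    "('g, 'b) monoid_scheme \<Rightarrow> 'g set \<Rightarrow> 'a set \<Rightarrow> ('g list \<times> 'a) set set \<Rightarrow> bool" where
  "codings_re_with_oracle_WP G S A C \<longleftrightarrow>
     recursively_enumerable_in (map Inl ` word_problem G S) (S <+> A)
       {encode_listing cs |cs. set cs \<in> C}"

end

theory Submission
  imports Defs "HOL-Library.Countable_Set"
begin

text \<open>
  A \<open>G\<close>-machine \<open>M\<close> accepting \<open>L\<close> is simulated by an oracle Turing machine that never names a group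
  element. The codings accepted by the simulation form the set \<open>C\<close>.

  The oracle tape is only ever appended to, so it holds a word \<open>z\<close> and acts as a register for one group
  element: writing the letter \<open>s\<close> multiplies the register by \<open>s\<close> on the right, and the query tells
  whether the register is \<open>\<one>\<close>. Inverses of generators are generators, so multiplications can be undone
  by writing more letters; nothing is ever erased.

  The tape of \<open>M\<close> is represented by a program recording how it came about: \<open>Move s\<close> moves the head,
  \<open>Mark b\<close> adds the letter \<open>b\<close> of a coded pattern at the current position, and \<open>Write b\<close> overwrites.
  A listing becomes a program by replacing each pair \<open>(w, a)\<close> by a walk along \<open>w\<close>, \<open>Mark a\<close>, and the
  walk back along the inverse of \<open>w\<close>; a stack tape provides the reversal (\<open>translate_listing\<close>). To read
  the symbol under the head of \<open>M\<close>, the simulator runs through the program backwards, multiplying by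
  the inverses of all moves, so that the register becomes \<open>g\<^sup>-\<^sup>1\<close> for the current position \<open>g\<close>; then it
  runs forwards, multiplying by the moves. Just before an instruction executed at position \<open>h\<close> the
  register holds \<open>g\<^sup>-\<^sup>1 h\<close>, so the query tells whether the instruction concerns the current cell. At the
  end the register is \<open>\<one>\<close> again (\<open>scan_program\<close>), and one step of \<open>M\<close> appends a \<open>Write\<close> and a \<open>Move\<close>
  (\<open>simulates_step\<close>).

  Acceptance must depend only on the coding and not on how it is listed, even for inconsistent
  codings. For this reason a cell holds the set of all letters marked there, which is read as a
  blank unless it is a singleton (\<open>symbol_of\<close>). A coding thereby always defines a tape
  (\<open>coding_fill\<close>), which for consistent codings is the tape of the coded pattern. Inconsistent codings in
  \<open>C\<close> do no harm, because \<open>coded_patterns\<close> ignores them. Conversely, every pattern has a consistent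
  coding because \<open>S\<close> generates \<open>G\<close> (\<open>pattern_has_coding\<close>), so \<open>C\<close> codes exactly \<open>L\<close>.
\<close>

section \<open>Runs of oracle Turing machines\<close>

definition accepting_run :: "'i list set \<Rightarrow> 'i oracle_tm \<Rightarrow> nat \<times> 'i tape list \<Rightarrow> bool" where
  "accepting_run X M c \<longleftrightarrow> (\<exists>n. fst ((tm_step X M ^^ n) c) \<in> tm_accepting M)"

text \<open>
  Along quiet steps acceptance can be transported in both directions, because no accepting
  configuration is passed.
\<close>

definition quiet_step ::
    "'i list set \<Rightarrow> 'i oracle_tm \<Rightarrow> nat \<times> 'i tape list \<Rightarrow> nat \<times> 'i tape list \<Rightarrow> bool" where
  "quiet_step X M c c' \<longleftrightarrow> fst c \<notin> tm_accepting M \<and> c' = tm_step X M c"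

lemma accepting_later_if_quiet_step:
  assumes "quiet_step X M c c'" "fst ((tm_step X M ^^ n) c) \<in> tm_accepting M"
  shows "\<exists>m<n. fst ((tm_step X M ^^ m) c') \<in> tm_accepting M"
proof (cases n)
  case 0
  with assms show ?thesis by (simp add: quiet_step_def)
next
  case (Suc m)
  with assms show ?thesis
    by (auto simp: quiet_step_def funpow_Suc_right simp del: funpow.simps)
qed

lemma accepting_later_if_quiet_steps:
  assumes "(quiet_step X M)\<^sup>+\<^sup>+ c c'" "fst ((tm_step X M ^^ n) c) \<in> tm_accepting M"
  shows "\<exists>m<n. fst ((tm_step X M ^^ m) c') \<in> tm_accepting M"
  using assms
proof (induction arbitrary: n rule: tranclp_induct)
  case (base c')
  then show ?case by (rule accepting_later_if_quiet_step)
next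
  case (step c' c'')
  then obtain m where "m < n" "fst ((tm_step X M ^^ m) c') \<in> tm_accepting M" by blast
  with accepting_later_if_quiet_step[OF step.hyps(2)] show ?case
    using less_trans by blast
qed

lemma accepting_run_quiet_steps:
  assumes "(quiet_step X M)\<^sup>*\<^sup>* c c'"
  shows "accepting_run X M c \<longleftrightarrow> accepting_run X M c'"
  using assms
proof (induction rule: rtranclp_induct)
  case (step c' c'')
  have "accepting_run X M c' \<longleftrightarrow> accepting_run X M c''"
  proof
    assume "accepting_run X M c'"
    then show "accepting_run X M c''"
      using accepting_later_if_quiet_step[OF step.hyps(2)] by (auto simp: accepting_run_def)
  next
    assume "accepting_run X M c''"
    then obtain n where "fst ((tm_step X M ^^ n) c'') \<in> tm_accepting M"
      by (auto simp: accepting_run_def)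
    then have "fst ((tm_step X M ^^ Suc n) c') \<in> tm_accepting M"
      using step.hyps(2) by (simp add: quiet_step_def funpow_Suc_right del: funpow.simps)
    then show "accepting_run X M c'" unfolding accepting_run_def by blast
  qed
  with step.IH show ?case by simp
qed simp

text \<open>
  The only way in which the simulator rejects is by running forever. If a set of configurations is
  re-entered again and again by at least one quiet step, an accepting configuration reached after
  \<open>n\<close> steps from a member would be reached after fewer steps from another member: an infinite descent.
\<close>

lemma no_accepting_run_if_recurrent:
  assumes recurrent: "\<And>c. c \<in> I \<Longrightarrow> \<exists>c' \<in> I. (quiet_step X M)\<^sup>+\<^sup>+ c c'" and "c \<in> I"
  shows "\<not> accepting_run X M c"
proof -
  have "fst ((tm_step X M ^^ n) c) \<notin> tm_accepting M" for n
    using \<open>c \<in> I\<close>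
  proof (induction n arbitrary: c rule: less_induct)
    case (less n)
    obtain c' where "c' \<in> I" "(quiet_step X M)\<^sup>+\<^sup>+ c c'" using recurrent less.prems by blast
    with less.IH show ?case using accepting_later_if_quiet_steps by blast
  qed
  then show ?thesis by (simp add: accepting_run_def)
qed


section \<open>Tapes holding lists\<close>

definition cells :: "'i tape_symbol list \<Rightarrow> int \<Rightarrow> 'i tape_symbol" where
  "cells xs = (\<lambda>i. if 0 \<le> i \<and> i < int (length xs) then xs ! nat i else Blank)"

lemma word_content_cells: "word_content w = cells (map Letter w)"
  by (auto simp: word_content_def cells_def fun_eq_iff)

lemma cells_overwrite [simp]: "(cells [x])(0 := y) = cells [y]"
  by (auto simp: cells_def fun_eq_iff)

lemma cells_single [simp]: "cells [x] 0 = x"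
  by (simp add: cells_def)

lemma cells_Blank: "cells [Blank] = cells []"
  by (auto simp: cells_def fun_eq_iff)

lemma inj_word_content: "inj word_content"
proof (rule injI)
  fix u v :: "'i list"
  assume eq: "word_content u = word_content v"
  have pointwise: "word_content u i = word_content v i" for i
    by (simp add: eq)
  have "\<not> length u < length v" "\<not> length v < length u"
    using pointwise[of "int (length u)"] pointwise[of "int (length v)"]
    by (auto simp: word_content_def)
  then have "length u = length v" by simp
  moreover have "u ! i = v ! i" if "i < length u" for i
    using pointwise[of "int i"] that \<open>length u = length v\<close> by (simp add: word_content_def)
  ultimately show "u = v" by (rule nth_equalityI)
qed


section \<open>Words and programs\<close>

context group
begin

lemma word_value_closed [simp]:
  "set w \<subseteq> carrier G \<Longrightarrow> word_value G w \<in> carrier G"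
  by (induction w) (auto simp: word_value_def)

lemma word_value_Nil [simp]: "word_value G [] = \<one>"
  by (simp add: word_value_def)

lemma word_value_Cons [simp]: "word_value G (s # w) = s \<otimes> word_value G w"
  by (simp add: word_value_def)

lemma word_value_append [simp]:
  "set u \<subseteq> carrier G \<Longrightarrow> set v \<subseteq> carrier G \<Longrightarrow>
    word_value G (u @ v) = word_value G u \<otimes> word_value G v"
  by (induction u) (auto simp: m_assoc)

lemma word_value_inverse [simp]:
  "set w \<subseteq> carrier G \<Longrightarrow> word_value G (rev (map (m_inv G) w)) = inv (word_value G w)"
proof (induction w)
  case (Cons s w)
  then have "set (rev (map (m_inv G) w)) \<subseteq> carrier G" by auto
  with Cons show ?case by (simp add: inv_mult_group)
qed simp

lemma word_for_generated:
  assumes "S \<subseteq> carrier G" "\<And>s. s \<in> S \<Longrightarrow> inv s \<in> S" "g \<in> generate G S"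
  shows "\<exists>w \<in> lists S. word_value G w = g"
  using assms(3)
proof (induction rule: generate.induct)
  case one
  then show ?case by (intro bexI[of _ "[]"]) auto
next
  case (incl s)
  then show ?case using assms(1) by (intro bexI[of _ "[s]"]) auto
next
  case (inv s)
  then show ?case using assms(1) assms(2)[of s] by (intro bexI[of _ "[inv s]"]) auto
next
  case (eng g h)
  then obtain u v where "u \<in> lists S" "word_value G u = g" "v \<in> lists S" "word_value G v = h"
    by blast
  then show ?case using assms(1) by (intro bexI[of _ "u @ v"]) (auto simp: in_lists_conv_set subset_iff)
qed

end

text \<open>
  \<open>Mark\<close> and \<open>Write\<close> differ in that marks accumulate while a write replaces the whole content of the
  cell: marks stem from the input, where their order must not matter, and writes from the machine.
\<close>

datatype ('g, 's) instr = Move 'g | Mark 's | Write 's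

fun moves :: "('g, 's) instr list \<Rightarrow> 'g list" where
  "moves [] = []"
| "moves (Move s # P) = s # moves P"
| "moves (_ # P) = moves P"

lemma moves_append [simp]: "moves (P @ P') = moves P @ moves P'"
  by (induction P rule: moves.induct) auto

text \<open>
  The state is the position of the head together with the set of symbols in each cell. In contrast
  to the \<open>G\<close>-machines of the theorem, the head moves and the content stays in place.
\<close>

fun exec ::
    "('g, 'b) monoid_scheme \<Rightarrow> 'g \<times> ('g \<Rightarrow> 's set) \<Rightarrow> ('g, 's) instr \<Rightarrow> 'g \<times> ('g \<Rightarrow> 's set)" where
  "exec G (g, X) (Move s) = (g \<otimes>\<^bsub>G\<^esub> s, X)"
| "exec G (g, X) (Mark b) = (g, X(g := insert b (X g)))"
| "exec G (g, X) (Write b) = (g, X(g := {b}))"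

definition trail :: "('g, 'b) monoid_scheme \<Rightarrow> ('g, 's) instr list \<Rightarrow> 'g \<times> ('g \<Rightarrow> 's set)" where
  "trail G P = foldl (exec G) (\<one>\<^bsub>G\<^esub>, \<lambda>_. {}) P"

text \<open>
  Any function of the set would make the result independent of the order of a listing; it only
  has to return the letter of a singleton and the blank for the empty set.
\<close>

definition symbol_of :: "'s \<Rightarrow> 's set \<Rightarrow> 's" where
  "symbol_of b B = (if is_singleton B then the_elem B else b)"

lemma symbol_of_simps [simp]: "symbol_of b {} = b" "symbol_of b {c} = c"
  by (auto simp: symbol_of_def is_singleton_def)

lemma symbol_of_in: "b \<in> T \<Longrightarrow> B \<subseteq> T \<Longrightarrow> symbol_of b B \<in> T"
  by (auto simp: symbol_of_def is_singleton_def)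

definition coding_content ::
    "('g, 'b) monoid_scheme \<Rightarrow> ('g list \<times> 'a) set \<Rightarrow> 'g \<Rightarrow> ('a + nat) set" where
  "coding_content G c h = {Inl a |a. \<exists>w. (w, a) \<in> c \<and> word_value G w = h}"

definition pair_program ::
    "('g, 'b) monoid_scheme \<Rightarrow> 'g list \<times> 'a \<Rightarrow> ('g, 'a + nat) instr list" where
  "pair_program G = (\<lambda>(w, a). map Move w @ Mark (Inl a) # map Move (rev (map (m_inv G) w)))"

definition listing_program ::
    "('g, 'b) monoid_scheme \<Rightarrow> ('g list \<times> 'a) list \<Rightarrow> ('g, 'a + nat) instr list" where
  "listing_program G cs = concat (map (pair_program G) cs)"

context group
begin

lemma foldl_exec_moves:
  "g \<in> carrier G \<Longrightarrow> set w \<subseteq> carrier G \<Longrightarrow>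
    foldl (exec G) (g, X) (map Move w) = (g \<otimes> word_value G w, X)"
  by (induction w arbitrary: g) (auto simp: m_assoc)

lemma fst_foldl_exec:
  "g \<in> carrier G \<Longrightarrow> set (moves P) \<subseteq> carrier G \<Longrightarrow>
    fst (foldl (exec G) (g, X) P) = g \<otimes> word_value G (moves P)"
  by (induction P arbitrary: g X rule: moves.induct) (auto simp: m_assoc)

lemma fst_trail:
  "set (moves P) \<subseteq> carrier G \<Longrightarrow> fst (trail G P) = word_value G (moves P)"
  by (simp add: trail_def fst_foldl_exec)

lemma foldl_exec_pair_program:
  assumes "set w \<subseteq> carrier G"
  shows "foldl (exec G) (\<one>, X) (pair_program G (w, a)) =
    (\<one>, X(word_value G w := insert (Inl a) (X (word_value G w))))"
proof -
  have "set (rev (map (m_inv G) w)) \<subseteq> carrier G" using assms by auto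
  then show ?thesis
    using assms by (simp add: pair_program_def foldl_exec_moves)
qed

lemma trail_listing_program:
  assumes "fst ` set cs \<subseteq> lists (carrier G)"
  shows "trail G (listing_program G cs) = (\<one>, coding_content G (set cs))"
  using assms
proof (induction cs rule: rev_induct)
  case Nil
  then show ?case by (simp add: trail_def listing_program_def coding_content_def fun_eq_iff)
next
  case (snoc wa cs)
  obtain w a where wa: "wa = (w, a)" by fastforce
  have "set w \<subseteq> carrier G" using snoc.prems wa by auto
  have "trail G (listing_program G (cs @ [wa])) =
      foldl (exec G) (trail G (listing_program G cs)) (pair_program G (w, a))"
    by (simp add: trail_def listing_program_def wa)
  also have "\<dots> = (\<one>, coding_content G (set (cs @ [wa])))"
    using snoc \<open>set w \<subseteq> carrier G\<close>
    by (auto simp: foldl_exec_pair_program coding_content_def fun_eq_iff wa)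
  finally show ?case .
qed

end

text \<open>
  Letters from \<open>A\<close> end the pairs, so an input fails to be a listing only by a dangling word at its end.
\<close>

lemma listing_decomposition:
  assumes "x \<in> lists (S <+> A)"
  shows "\<exists>cs w. set cs \<subseteq> lists S \<times> A \<and> set w \<subseteq> S \<and> x = encode_listing cs @ map Inl w"
  using assms
proof (induction x rule: rev_induct)
  case Nil
  show ?case by (intro exI[of _ "[]"]) (simp add: encode_listing_def)
next
  case (snoc b x)
  then obtain cs w where cs: "set cs \<subseteq> lists S \<times> A" "set w \<subseteq> S" "x = encode_listing cs @ map Inl w"
    by auto
  show ?case
  proof (cases b)
    case (Inl s)
    with snoc.prems cs show ?thesis
      by (intro exI[of _ cs] exI[of _ "w @ [s]"]) auto
  next
    case (Inr a)
    with snoc.prems cs show ?thesis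
      by (intro exI[of _ "cs @ [(w, a)]"] exI[of _ "[]"]) (auto simp: encode_listing_def)
  qed
qed

section \<open>The simulating machine\<close>

text \<open>
  The modes of the simulator. \<open>Read\<close> translates the input, with a flag telling whether the head is
  at the beginning of a pair, the only place where the input may end; \<open>Unwind\<close> empties the stack, writing the way back
  of a pair. \<open>Back q\<close> and \<open>Forth q B\<close> are the two passes over the program when the group machine is in
  state \<open>q\<close>, where \<open>B\<close> is the content of the current cell according to the instructions passed so far. \<open>Emit q s\<close>
  appends the move after a write.
\<close>

datatype ('g, 's) mode =
    Read bool
  | Unwind
  | Back nat
  | Forth nat "'s set"
  | Emit nat 'g

text \<open>
  \<open>Act m w d bd bd'\<close> enters mode \<open>m\<close>, appends the letter \<open>w\<close> (if any) to the oracle tape, moves the head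
  of the read-only input tape by \<open>d\<close>, and writes and moves on the program tape by \<open>bd\<close> and on the stack tape by \<open>bd'\<close>.
\<close>

datatype ('g, 'a) action =
    Accept
  | Loop
  | Act "('g, 'a + nat) mode" "'g option" move
      "('g + 'a) tape_symbol \<times> move" "('g + 'a) tape_symbol \<times> move"

definition read :: "'i tape \<Rightarrow> 'i tape_symbol" where
  "read t = fst t (snd t)"

definition write_move :: "'i tape_symbol \<times> move \<Rightarrow> 'i tape \<Rightarrow> 'i tape" where
  "write_move bd t = ((fst t)(snd t := fst bd), move_head (snd bd) (snd t))"

locale machine_simulation = group G for G :: "('g, 'b) monoid_scheme" (structure) +
  fixes S :: "'g set" and A :: "'a set" and M :: "('g, 'a + nat, nat) g_machine"
  assumes finite_S: "finite S" and S_carrier: "S \<subseteq> carrier G"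
    and S_inv: "\<And>s. s \<in> S \<Longrightarrow> inv s \<in> S"
    and finite_A: "finite A"
    and machine: "is_g_machine S M" and A_alphabet: "Inl ` A \<subseteq> gm_alphabet M"
begin

definition instrs :: "('g, 'a + nat) instr set" where
  "instrs = Move ` S \<union> Mark ` gm_alphabet M \<union> Write ` gm_alphabet M"

definition modes :: "('g, 'a + nat) mode set" where
  "modes = {Read True, Read False, Unwind} \<union> Back ` gm_states M
     \<union> case_prod Forth ` (gm_states M \<times> Pow (gm_alphabet M))
     \<union> case_prod Emit ` (gm_states M \<times> S)"

definition instr_symbol :: "('g, 'a + nat) instr \<Rightarrow> ('g + 'a) tape_symbol" where
  "instr_symbol i = Aux (to_nat_on instrs i)"

definition instr_of :: "('g + 'a) tape_symbol \<Rightarrow> ('g, 'a + nat) instr option" where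
  "instr_of b = (case b of Aux n \<Rightarrow> Some (from_nat_into instrs n) | _ \<Rightarrow> None)"

text \<open>
  The initial mode must be represented by the blank, since the tape with the mode starts out empty.
\<close>

definition mode_symbol :: "('g, 'a + nat) mode \<Rightarrow> ('g + 'a) tape_symbol" where
  "mode_symbol m = (if m = Read True then Blank else Aux (to_nat_on modes m))"

definition mode_of :: "('g + 'a) tape_symbol \<Rightarrow> ('g, 'a + nat) mode" where
  "mode_of b = (case b of Aux n \<Rightarrow> from_nat_into modes n | _ \<Rightarrow> Read True)"

definition symbols :: "('g + 'a) tape_symbol set" where
  "symbols = {Blank} \<union> Letter ` (S <+> A) \<union> instr_symbol ` instrs \<union> mode_symbol ` modes"

definition control ::
    "bool \<Rightarrow> ('g, 'a + nat) mode \<Rightarrow> ('g + 'a) tape_symbol \<Rightarrow> ('g + 'a) tape_symbol \<Rightarrow>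
      ('g + 'a) tape_symbol \<Rightarrow> ('g, 'a) action" where
  "control at_one m a0 a2 a3 =
    (case m of
      Read b \<Rightarrow>
        (case a0 of
          Letter (Inl s) \<Rightarrow> Act (Read False) None Move_Right
            (instr_symbol (Move s), Move_Right) (Letter (Inl (inv s)), Move_Right)
        | Letter (Inr a) \<Rightarrow> Act Unwind None Move_Right
            (instr_symbol (Mark (Inl a)), Move_Right) (a3, Move_Left)
        | Blank \<Rightarrow>
            if b then Act (Back (gm_init M)) None Stay (a2, Move_Left) (a3, Stay) else Loop
        | Aux n \<Rightarrow> Loop)
    | Unwind \<Rightarrow>
        (case a3 of
          Letter (Inl s) \<Rightarrow> Act Unwind None Stay
            (instr_symbol (Move s), Move_Right) (Blank, Move_Left)
        | _ \<Rightarrow> Act (Read True) None Stay (a2, Stay) (a3, Move_Right))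
    | Back q \<Rightarrow>
        (case instr_of a2 of
          Some (Move s) \<Rightarrow> Act (Back q) (Some (inv s)) Stay (a2, Move_Left) (a3, Stay)
        | Some _ \<Rightarrow> Act (Back q) None Stay (a2, Move_Left) (a3, Stay)
        | None \<Rightarrow> Act (Forth q {}) None Stay (a2, Move_Right) (a3, Stay))
    | Forth q B \<Rightarrow>
        (case instr_of a2 of
          Some (Move s) \<Rightarrow> Act (Forth q B) (Some s) Stay (a2, Move_Right) (a3, Stay)
        | Some (Mark b) \<Rightarrow> Act (Forth q (if at_one then insert b B else B)) None Stay
            (a2, Move_Right) (a3, Stay)
        | Some (Write b) \<Rightarrow> Act (Forth q (if at_one then {b} else B)) None Stay
            (a2, Move_Right) (a3, Stay)
        | None \<Rightarrow>
            if q \<in> gm_accepting M then Accept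
            else (case gm_delta M (symbol_of (gm_blank M) B) q of
              (b, q', s) \<Rightarrow> Act (Emit q' s) None Stay
                (instr_symbol (Write b), Move_Right) (a3, Stay)))
    | Emit q s \<Rightarrow> Act (Back q) None Stay (instr_symbol (Move s), Stay) (a3, Stay))"

definition admissible ::
    "('g, 'a + nat) mode \<Rightarrow> 'g option \<Rightarrow> ('g + 'a) tape_symbol \<Rightarrow> ('g + 'a) tape_symbol \<Rightarrow> bool" where
  "admissible m w b2 b3 \<longleftrightarrow> m \<in> modes \<and> set_option w \<subseteq> S \<and> b2 \<in> symbols \<and> b3 \<in> symbols"

text \<open>
  A query moves to one of two fixed states and so forgets all other information in the state.
  Hence the mode is kept in a single cell of tape 4, and the state only tells whether the next step is a query
  (\<open>0\<close>), has been answered by yes (\<open>1\<close>) or no (\<open>2\<close>), or whether the input has been accepted (\<open>3\<close>).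
  The simulator queries before every action. Tape 2 holds the program, tape 3 the stack.
  The test for \<open>admissible\<close> actions keeps the machine within its finite alphabet on tape
  contents that never occur in a run.
\<close>

definition simulator_delta ::
    "nat \<Rightarrow> ('g + 'a) tape_symbol list \<Rightarrow> nat \<times> ('g + 'a) tape_symbol list \<times> move list" where
  "simulator_delta k as =
    (case control (k = 1) (mode_of (as ! 4)) (as ! 0) (as ! 2) (as ! 3) of
      Accept \<Rightarrow> (3, as, replicate 5 Stay)
    | Loop \<Rightarrow> (0, as, replicate 5 Stay)
    | Act m w d0 bd2 bd3 \<Rightarrow>
        if admissible m w (fst bd2) (fst bd3)
        then (0,
          [as ! 0, case w of None \<Rightarrow> as ! 1 | Some s \<Rightarrow> Letter (Inl s),
            fst bd2, fst bd3, mode_symbol m],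
          [d0, if w = None then Stay else Move_Right, snd bd2, snd bd3, Stay])
        else (0, as, replicate 5 Stay))"

definition simulator :: "('g + 'a) oracle_tm" where
  "simulator = \<lparr> tm_tapes = 5, tm_states = {0, 1, 2, 3}, tm_alphabet = symbols, tm_init = 0,
     tm_accepting = {3}, tm_query = 0, tm_yes = 1, tm_no = 2, tm_delta = simulator_delta \<rparr>"

abbreviation WP :: "('g + 'a) list set" where
  "WP \<equiv> map Inl ` word_problem G S"

abbreviation next_config where "next_config \<equiv> tm_step WP simulator"
abbreviation quiet where "quiet \<equiv> quiet_step WP simulator"

lemma machine_facts:
  "finite (gm_states M)" "finite (gm_alphabet M)" "gm_blank M \<in> gm_alphabet M"
  "gm_init M \<in> gm_states M" "gm_accepting M \<subseteq> gm_states M"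
  using machine by (auto simp: is_g_machine_def)

lemma delta_closed:
  assumes "b \<in> gm_alphabet M" "q \<in> gm_states M" "gm_delta M b q = (b', q', s)"
  shows "b' \<in> gm_alphabet M" "q' \<in> gm_states M" "s \<in> S"
proof -
  have "gm_delta M b q \<in> gm_alphabet M \<times> gm_states M \<times> S"
    using machine assms(1,2) unfolding is_g_machine_def by blast
  then show "b' \<in> gm_alphabet M" "q' \<in> gm_states M" "s \<in> S"
    by (simp_all add: assms(3))
qed

lemma finite_instrs: "finite instrs"
  using finite_S machine_facts by (simp add: instrs_def)

lemma finite_modes: "finite modes"
  using finite_S machine_facts by (simp add: modes_def)

lemma instr_of_symbol [simp]: "i \<in> instrs \<Longrightarrow> instr_of (instr_symbol i) = Some i"
  by (simp add: instr_of_def instr_symbol_def finite_instrs countable_finite)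

lemma instr_of_Blank [simp]: "instr_of Blank = None"
  by (simp add: instr_of_def)

lemma mode_of_symbol [simp]: "m \<in> modes \<Longrightarrow> mode_of (mode_symbol m) = m"
  by (simp add: mode_of_def mode_symbol_def finite_modes countable_finite)

lemma modes_simps [simp]:
  "Read b \<in> modes" "Unwind \<in> modes" "Back q \<in> modes \<longleftrightarrow> q \<in> gm_states M"
  "Forth q B \<in> modes \<longleftrightarrow> q \<in> gm_states M \<and> B \<subseteq> gm_alphabet M"
  "Emit q s \<in> modes \<longleftrightarrow> q \<in> gm_states M \<and> s \<in> S"
  by (cases b) (auto simp: modes_def)

lemma instrs_simps [simp]:
  "Move s \<in> instrs \<longleftrightarrow> s \<in> S" "Mark b \<in> instrs \<longleftrightarrow> b \<in> gm_alphabet M"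
  "Write b \<in> instrs \<longleftrightarrow> b \<in> gm_alphabet M"
  by (auto simp: instrs_def)

lemma symbols_simps [simp]:
  "Blank \<in> symbols" "s \<in> S \<Longrightarrow> Letter (Inl s) \<in> symbols" "i \<in> instrs \<Longrightarrow> instr_symbol i \<in> symbols"
  "m \<in> modes \<Longrightarrow> mode_symbol m \<in> symbols"
  by (auto simp: symbols_def)

lemma moves_in_S: "set P \<subseteq> instrs \<Longrightarrow> set (moves P) \<subseteq> S"
  by (induction P rule: moves.induct) auto

lemma moves_in_carrier: "set P \<subseteq> instrs \<Longrightarrow> set (moves P) \<subseteq> carrier G"
  using moves_in_S S_carrier by blast

lemma is_oracle_tm_simulator: "is_oracle_tm (S <+> A) simulator"
proof -
  have "case simulator_delta k as of (k', bs, ds) \<Rightarrow>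
      k' \<in> {0, 1, 2, 3} \<and> bs \<in> lists symbols \<and> length bs = 5 \<and> length ds = 5"
    if "as \<in> lists symbols" "length as = 5" for k as
  proof -
    have "as ! 0 \<in> symbols" "as ! 1 \<in> symbols"
      using that by (auto simp: in_lists_conv_set)
    then show ?thesis
      using that unfolding simulator_delta_def
      by (auto simp: admissible_def split: action.split option.split)
  qed
  then show ?thesis
    unfolding is_oracle_tm_def simulator_def
    by (simp add: symbols_def finite_S finite_A finite_instrs finite_modes) blast
qed

text \<open>
  The configurations before a query; the oracle tape holds the word \<open>z\<close>, with the head at its end.
\<close>

definition config ::
    "('g, 'a + nat) mode \<Rightarrow> ('g + 'a) tape \<Rightarrow> 'g list \<Rightarrow> ('g + 'a) tape \<Rightarrow> ('g + 'a) tape \<Rightarrow>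
      nat \<times> ('g + 'a) tape list" where
  "config m t0 z t2 t3 = (0,
     [t0, (word_content (map Inl z), int (length z)), t2, t3, (cells [mode_symbol m], 0)])"

definition program_tape :: "('g, 'a + nat) instr list \<Rightarrow> int \<Rightarrow> ('g + 'a) tape" where
  "program_tape P k = (cells (map instr_symbol P), k)"

lemma query_answer:
  assumes "set z \<subseteq> S"
  shows "word_content (map Inl z) \<in> word_content ` WP \<longleftrightarrow> word_value G z = \<one>"
proof -
  have "word_content (map Inl z) \<in> word_content ` WP \<longleftrightarrow> map Inl z \<in> WP"
    by (rule inj_image_mem_iff[OF inj_word_content])
  also have "\<dots> \<longleftrightarrow> z \<in> word_problem G S"
    by (rule inj_image_mem_iff) simp
  finally show ?thesis using assms by (simp add: word_problem_def in_lists_conv_set subset_iff)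
qed

lemma next_config_query:
  assumes "set z \<subseteq> S"
  shows "next_config (config m t0 z t2 t3) =
    (if word_value G z = \<one> then 1 else 2, snd (config m t0 z t2 t3))"
  by (simp add: config_def simulator_def query_answer[OF assms])

lemma quiet_config:
  assumes "set z \<subseteq> S"
    and "next_config (if word_value G z = \<one> then 1 else 2, snd (config m t0 z t2 t3)) = c"
  shows "quiet\<^sup>+\<^sup>+ (config m t0 z t2 t3) c"
proof -
  let ?k = "if word_value G z = \<one> then 1 else 2 :: nat"
  have "quiet (config m t0 z t2 t3) (?k, snd (config m t0 z t2 t3))"
    by (simp only: quiet_step_def next_config_query[OF assms(1)])
      (simp add: config_def simulator_def)
  moreover have "quiet (?k, snd (config m t0 z t2 t3)) c"
    using assms(2) by (simp add: quiet_step_def simulator_def)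
  ultimately show ?thesis by (meson tranclp.r_into_trancl tranclp.trancl_into_trancl)
qed

lemma word_content_update_end [simp]:
  "(word_content w)(int (length w) := Blank) = word_content w"
  "(word_content w)(int (length w) := Letter s) = word_content (w @ [s])"
  by (auto simp: word_content_def fun_eq_iff nth_append)

text \<open>
  One action of the control unit takes two steps, the query and the transition after its answer.
  With this lemma the remaining proofs reason about \<open>control\<close> only.
\<close>

lemma config_step:
  assumes "set z \<subseteq> S" "m \<in> modes"
    and "control (word_value G z = \<one>) m (read t0) (read t2) (read t3) = Act m' w d0 bd2 bd3"
    and "admissible m' w (fst bd2) (fst bd3)"
  shows "quiet\<^sup>+\<^sup>+ (config m t0 z t2 t3)
    (config m' (write_move (read t0, d0) t0) (z @ (case w of None \<Rightarrow> [] | Some s \<Rightarrow> [s]))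
      (write_move bd2 t2) (write_move bd3 t3))"
proof (rule quiet_config[OF assms(1)])
  let ?k = "if word_value G z = \<one> then 1 else 2 :: nat"
  obtain f0 h0 f2 h2 f3 h3 where t: "t0 = (f0, h0)" "t2 = (f2, h2)" "t3 = (f3, h3)"
    by (metis surj_pair)
  obtain b2 d2 b3 d3 where bd: "bd2 = (b2, d2)" "bd3 = (b3, d3)" by (metis surj_pair)
  have ctrl: "control (?k = 1) m (f0 h0) (f2 h2) (f3 h3) = Act m' w d0 (b2, d2) (b3, d3)"
    using assms(3) by (cases "word_value G z = \<one>") (simp_all add: t bd read_def)
  have "word_content (map Inl z) (int (length z)) = (Blank :: ('g + 'a) tape_symbol)"
    by (simp add: word_content_def)
  then have delta: "simulator_delta ?k
      [f0 h0, word_content (map Inl z) (int (length z)), f2 h2, f3 h3, mode_symbol m] =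
      (0, [f0 h0, case w of None \<Rightarrow> Blank | Some s \<Rightarrow> Letter (Inl s), b2, b3, mode_symbol m'],
        [d0, if w = None then Stay else Move_Right, d2, d3, Stay])"
    using assms(2,4) ctrl by (cases w) (simp_all add: simulator_delta_def bd)
  have oracle_None: "(word_content (map Inl z))(int (length z) := Blank) =
      (word_content (map Inl z) :: int \<Rightarrow> ('g + 'a) tape_symbol)"
    using word_content_update_end(1)[of "map Inl z :: ('g + 'a) list"] by simp
  have oracle_Some: "(word_content (map Inl z))(int (length z) := Letter (Inl s)) =
      (word_content (map Inl (z @ [s])) :: int \<Rightarrow> ('g + 'a) tape_symbol)" for s
    using word_content_update_end(2)[of "map Inl z :: ('g + 'a) list" "Inl s"] by simp
  show "next_config (?k, snd (config m t0 z t2 t3)) =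
    config m' (write_move (read t0, d0) t0) (z @ (case w of None \<Rightarrow> [] | Some s \<Rightarrow> [s]))
      (write_move bd2 t2) (write_move bd3 t3)"
    using delta
    by (cases w) (simp_all add: config_def simulator_def t bd write_move_def read_def
        oracle_None oracle_Some del: map_append)
qed

lemma config_loop:
  assumes "set z \<subseteq> S" "m \<in> modes"
    and "control (word_value G z = \<one>) m (read t0) (read t2) (read t3) = Loop"
  shows "quiet\<^sup>+\<^sup>+ (config m t0 z t2 t3) (config m t0 z t2 t3)"
proof (rule quiet_config[OF assms(1)])
  let ?k = "if word_value G z = \<one> then 1 else 2 :: nat"
  obtain f0 h0 f2 h2 f3 h3 where t: "t0 = (f0, h0)" "t2 = (f2, h2)" "t3 = (f3, h3)"
    by (metis surj_pair)
  have delta: "simulator_delta ?k [f0 h0, b, f2 h2, f3 h3, mode_symbol m] =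
      (0, [f0 h0, b, f2 h2, f3 h3, mode_symbol m], replicate 5 Stay)" for b
    using assms(2,3)
    by (cases "word_value G z = \<one>") (simp_all add: simulator_delta_def t read_def)
  show "next_config (?k, snd (config m t0 z t2 t3)) = config m t0 z t2 t3"
    using delta by (simp add: config_def simulator_def t eval_nat_numeral)
qed

lemma config_accept:
  assumes "set z \<subseteq> S" "m \<in> modes"
    and "control (word_value G z = \<one>) m (read t0) (read t2) (read t3) = Accept"
  shows "accepting_run WP simulator (config m t0 z t2 t3)"
proof -
  let ?k = "if word_value G z = \<one> then 1 else 2 :: nat"
  obtain f0 h0 f2 h2 f3 h3 where t: "t0 = (f0, h0)" "t2 = (f2, h2)" "t3 = (f3, h3)"
    by (metis surj_pair)
  have "fst (simulator_delta ?k [f0 h0, b, f2 h2, f3 h3, mode_symbol m]) = 3" for b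
    using assms(2,3)
    by (cases "word_value G z = \<one>") (simp_all add: simulator_delta_def t read_def)
  then have "fst (next_config (?k, snd (config m t0 z t2 t3))) = 3"
    by (simp add: config_def simulator_def t split_beta)
  then have "fst ((next_config ^^ 2) (config m t0 z t2 t3)) = 3"
    by (simp only: numeral_2_eq_2 funpow.simps comp_apply id_apply next_config_query[OF assms(1)])
  then show ?thesis
    unfolding accepting_run_def by (intro exI[of _ 2]) (simp add: simulator_def)
qed


section \<open>Translating a listing into a program\<close>

text \<open>
  The part \<open>u\<close> of the input has been read, the part \<open>v\<close> has not.
\<close>

definition input_tape :: "('g + 'a) list \<Rightarrow> ('g + 'a) list \<Rightarrow> ('g + 'a) tape" where
  "input_tape u v = (word_content (u @ v), int (length u))"

definition stack_tape :: "'g list \<Rightarrow> int \<Rightarrow> ('g + 'a) tape" where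
  "stack_tape v k = (word_content (map Inl v), k)"

abbreviation open_program where "open_program P \<equiv> program_tape P (int (length P))"
abbreviation open_stack where "open_stack v \<equiv> stack_tape v (int (length v))"

lemma read_input_tape [simp]:
  "read (input_tape u (x # v)) = Letter x" "read (input_tape u []) = Blank"
  by (simp_all add: read_def input_tape_def word_content_def)

lemma write_move_input_tape [simp]:
  "write_move (Letter x, Move_Right) (input_tape u (x # v)) = input_tape (u @ [x]) v"
  "write_move (Blank, Stay) (input_tape u []) = input_tape u []"
  by (auto simp: write_move_def input_tape_def word_content_def fun_eq_iff nth_append)

lemma write_move_Stay [simp]: "write_move (read t, Stay) t = t"
  by (simp add: write_move_def read_def)

lemma read_stack_tape [simp]:
  "read (open_stack v) = Blank" "read (stack_tape v (-1)) = Blank"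
  "read (stack_tape (v @ [s]) (int (length v))) = Letter (Inl s)" "read (stack_tape [] 0) = Blank"
  by (simp_all add: read_def stack_tape_def word_content_def nth_append)

lemma write_move_stack_tape [simp]:
  "write_move (Letter (Inl s), Move_Right) (open_stack v) = open_stack (v @ [s])"
  "write_move (Blank, d) (open_stack v) = stack_tape v (move_head d (int (length v)))"
  "write_move (Blank, d) (stack_tape v (-1)) = stack_tape v (move_head d (-1))"
  "write_move (Blank, d) (stack_tape (v @ [s]) (int (length v))) =
    stack_tape v (move_head d (int (length v)))"
  "write_move (Blank, d) (stack_tape [] 0) = stack_tape [] (move_head d 0)"
  by (auto simp: write_move_def stack_tape_def word_content_def fun_eq_iff nth_append)

lemma read_program_tape [simp]:
  "read (open_program P) = Blank" "read (program_tape P (-1)) = Blank"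
  "read (program_tape (P @ i # P') (int (length P))) = instr_symbol i"
  by (simp_all add: read_def program_tape_def cells_def nth_append)

lemma write_move_program_tape [simp]:
  "write_move (instr_symbol i, Move_Right) (open_program P) = open_program (P @ [i])"
  "write_move (instr_symbol i, Stay) (open_program P) = program_tape (P @ [i]) (int (length P))"
  "write_move (Blank, d) (open_program P) = program_tape P (move_head d (int (length P)))"
  "write_move (Blank, d) (program_tape P (-1)) = program_tape P (move_head d (-1))"
  "write_move (instr_symbol i, d) (program_tape (P @ i # P') (int (length P))) =
    program_tape (P @ i # P') (move_head d (int (length P)))"
  by (auto simp: write_move_def program_tape_def cells_def fun_eq_iff nth_append)

lemma read_generator:
  assumes "set z \<subseteq> S" "s \<in> S"
  shows "quiet\<^sup>+\<^sup>+
    (config (Read b) (input_tape u (Inl s # y)) z (open_program P) (open_stack v))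
    (config (Read False) (input_tape (u @ [Inl s]) y) z
      (open_program (P @ [Move s])) (open_stack (v @ [inv s])))"
  using config_step[of z "Read b" "input_tape u (Inl s # y)" "open_program P" "open_stack v"
      "Read False" None Move_Right "(instr_symbol (Move s), Move_Right)"
      "(Letter (Inl (inv s)), Move_Right)"] assms S_inv
  by (simp add: control_def admissible_def)

lemma read_word:
  assumes "set z \<subseteq> S" "set w \<subseteq> S"
  shows "quiet\<^sup>*\<^sup>*
    (config (Read b) (input_tape u (map Inl w @ y)) z (open_program P) (open_stack v))
    (config (Read (b \<and> w = [])) (input_tape (u @ map Inl w) y) z
      (open_program (P @ map Move w)) (open_stack (v @ map (m_inv G) w)))"
  using assms(2)
proof (induction w arbitrary: b u P v)
  case (Cons s w)
  have "quiet\<^sup>+\<^sup>+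
    (config (Read b) (input_tape u (Inl s # map Inl w @ y)) z (open_program P) (open_stack v))
    (config (Read False) (input_tape (u @ [Inl s]) (map Inl w @ y)) z
      (open_program (P @ [Move s])) (open_stack (v @ [inv s])))"
    using Cons.prems assms(1) by (intro read_generator) auto
  from rtranclp_trans[OF tranclp_into_rtranclp[OF this] Cons.IH] Cons.prems
  show ?case by simp
qed simp

lemma read_letter:
  assumes "set z \<subseteq> S" "a \<in> A"
  shows "quiet\<^sup>+\<^sup>+
    (config (Read b) (input_tape u (Inr a # y)) z (open_program P) (open_stack v))
    (config Unwind (input_tape (u @ [Inr a]) y) z
      (open_program (P @ [Mark (Inl a)])) (stack_tape v (int (length v) - 1)))"
  using config_step[of z "Read b" "input_tape u (Inr a # y)" "open_program P" "open_stack v"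
      Unwind None Move_Right "(instr_symbol (Mark (Inl a)), Move_Right)" "(Blank, Move_Left)"]
    assms A_alphabet
  by (simp add: control_def admissible_def image_subset_iff)

text \<open>
  After reading a word the stack holds the inverses of its letters, the last one on top, so popping it
  spells the way back.
\<close>

lemma unwind:
  assumes "set z \<subseteq> S" "set v \<subseteq> S"
  shows "quiet\<^sup>*\<^sup>*
    (config Unwind t0 z (open_program P) (stack_tape v (int (length v) - 1)))
    (config (Read True) t0 z (open_program (P @ map Move (rev v))) (open_stack []))"
  using assms(2)
proof (induction v arbitrary: P rule: rev_induct)
  case Nil
  show ?case
    using config_step[of z Unwind t0 "open_program P" "stack_tape [] (-1)"
      "Read True" None Stay "(Blank, Stay)" "(Blank, Move_Right)"] assms(1)
    by (simp add: control_def admissible_def tranclp_into_rtranclp)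
next
  case (snoc s v)
  have "quiet\<^sup>+\<^sup>+
    (config Unwind t0 z (open_program P) (stack_tape (v @ [s]) (int (length (v @ [s])) - 1)))
    (config Unwind t0 z (open_program (P @ [Move s])) (stack_tape v (int (length v) - 1)))"
    using config_step[of z Unwind t0 "open_program P" "stack_tape (v @ [s]) (int (length v))"
      Unwind None Stay "(instr_symbol (Move s), Move_Right)" "(Blank, Move_Left)"]
      assms(1) snoc.prems
    by (simp add: control_def admissible_def)
  from rtranclp_trans[OF tranclp_into_rtranclp[OF this] snoc.IH] snoc.prems
  show ?case by simp
qed

lemma translate_pair:
  assumes "set z \<subseteq> S" "set w \<subseteq> S" "a \<in> A"
  shows "quiet\<^sup>*\<^sup>*
    (config (Read True) (input_tape u (map Inl w @ Inr a # y)) z (open_program P) (open_stack []))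
    (config (Read True) (input_tape (u @ map Inl w @ [Inr a]) y) z
      (open_program (P @ pair_program G (w, a))) (open_stack []))"
proof -
  have "set (map (m_inv G) w) \<subseteq> S" using assms(2) S_inv by auto
  note u = unwind[OF assms(1) this, of "input_tape ((u @ map Inl w) @ [Inr a]) y"
      "(P @ map Move w) @ [Mark (Inl a)]"]
  note r = read_word[OF assms(1,2), of True u "Inr a # y" P "[]"]
  note l = read_letter[OF assms(1,3), of "True \<and> w = []" "u @ map Inl w" y
      "P @ map Move w" "map (m_inv G) w"]
  show ?thesis
    using rtranclp_trans[OF rtranclp_trans[OF r] u] l
    by (simp add: pair_program_def tranclp_into_rtranclp)
qed

lemma translate_listing:
  assumes "set z \<subseteq> S" "set cs \<subseteq> lists S \<times> A"
  shows "quiet\<^sup>*\<^sup>*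
    (config (Read True) (input_tape u (encode_listing cs @ y)) z (open_program P) (open_stack []))
    (config (Read True) (input_tape (u @ encode_listing cs) y) z
      (open_program (P @ listing_program G cs)) (open_stack []))"
  using assms(2)
proof (induction cs arbitrary: u P)
  case Nil
  then show ?case by (simp add: encode_listing_def listing_program_def)
next
  case (Cons wa cs)
  obtain w a where wa: "wa = (w, a)" by fastforce
  then have "set w \<subseteq> S" "a \<in> A" "set cs \<subseteq> lists S \<times> A" using Cons.prems by auto
  from rtranclp_trans[OF translate_pair[OF assms(1) this(1,2)] Cons.IH[OF this(3)]]
  show ?case by (simp add: wa encode_listing_def listing_program_def)
qed

lemma tm_start_simulator:
  "tm_start simulator x = config (Read True) (input_tape [] x) [] (open_program []) (open_stack [])"
  by (simp add: tm_start_def simulator_def config_def input_tape_def program_tape_def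
      stack_tape_def mode_symbol_def cells_Blank word_content_cells eval_nat_numeral)

lemma tm_accepts_listing:
  assumes "set cs \<subseteq> lists S \<times> A"
  shows "tm_accepts WP simulator (encode_listing cs @ y) \<longleftrightarrow>
    accepting_run WP simulator
      (config (Read True) (input_tape (encode_listing cs) y) []
        (open_program (listing_program G cs)) (open_stack []))"
  using accepting_run_quiet_steps[OF translate_listing[OF _ assms, of "[]" "[]" y "[]"]]
  unfolding tm_accepts_def accepting_run_def[symmetric] tm_start_simulator by simp

text \<open>
  At the end of the input the mode \<open>Read False\<close> has no action but to loop.
\<close>

lemma rejects_dangling_word:
  assumes "set cs \<subseteq> lists S \<times> A" "set w \<subseteq> S" "w \<noteq> []"
  shows "\<not> tm_accepts WP simulator (encode_listing cs @ map Inl w)"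
proof -
  let ?c = "config (Read False) (input_tape (encode_listing cs @ map Inl w) []) []
    (open_program (listing_program G cs @ map Move w)) (open_stack (map (m_inv G) w))"
  have "quiet\<^sup>+\<^sup>+ ?c ?c"
    by (rule config_loop) (simp_all add: control_def)
  then have "\<not> accepting_run WP simulator ?c"
    by (intro no_accepting_run_if_recurrent[of "{?c}"]) auto
  then show ?thesis
    using accepting_run_quiet_steps[OF read_word[OF _ assms(2), of "[]" True
        "encode_listing cs" "[]" "listing_program G cs" "[]"]] assms(3)
    by (simp add: tm_accepts_listing[OF assms(1)])
qed


section \<open>Simulating one step of the group machine\<close>

lemma rewind:
  assumes "set z \<subseteq> S" "q \<in> gm_states M" "set P \<subseteq> instrs"
  shows "quiet\<^sup>*\<^sup>*
    (config (Back q) t0 z (program_tape (P @ P') (int (length P) - 1)) (open_stack []))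
    (config (Back q) t0 (z @ rev (map (m_inv G) (moves P))) (program_tape (P @ P') (-1))
      (open_stack []))"
  using assms(1,3)
proof (induction P arbitrary: z P' rule: rev_induct)
  case Nil
  then show ?case by simp
next
  case (snoc i P)
  define w where "w = (case i of Move s \<Rightarrow> Some (inv s) | _ \<Rightarrow> None)"
  have w: "set_option w \<subseteq> S" using snoc.prems S_inv by (auto simp: w_def split: instr.splits)
  have "quiet\<^sup>+\<^sup>+
    (config (Back q) t0 z (program_tape (P @ i # P') (int (length P))) (open_stack []))
    (config (Back q) t0 (z @ (case w of None \<Rightarrow> [] | Some s \<Rightarrow> [s]))
      (program_tape (P @ i # P') (int (length P) - 1)) (open_stack []))"
    using config_step[of z "Back q" t0 "program_tape (P @ i # P') (int (length P))"
      "open_stack []" "Back q" w Stay "(instr_symbol i, Move_Left)" "(Blank, Stay)"]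
      snoc.prems assms(2) w
    by (cases i) (simp_all add: control_def admissible_def w_def)
  also have "quiet\<^sup>*\<^sup>* \<dots> (config (Back q) t0
      ((z @ (case w of None \<Rightarrow> [] | Some s \<Rightarrow> [s])) @ rev (map (m_inv G) (moves P)))
      (program_tape (P @ i # P') (-1)) (open_stack []))"
    using snoc.prems w by (intro snoc.IH) (auto split: option.splits)
  also have "(z @ (case w of None \<Rightarrow> [] | Some s \<Rightarrow> [s])) @ rev (map (m_inv G) (moves P)) =
      z @ rev (map (m_inv G) (moves (P @ [i])))"
    by (cases i) (simp_all add: w_def)
  finally show ?case by (simp add: tranclp_into_rtranclp)
qed

text \<open>
  The register is \<open>t\<^sup>-\<^sup>1 g\<close> whenever the program is at position \<open>g\<close>, and it is \<open>\<one>\<close> exactly if \<open>g = t\<close>.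
  Thus the set in the mode follows the content of cell \<open>t\<close> through the execution of the program.
\<close>

lemma look_up:
  assumes "set z \<subseteq> S" "q \<in> gm_states M" "set P' \<subseteq> instrs" "t \<in> carrier G" "g \<in> carrier G"
    and "word_value G z = inv t \<otimes> g" "X t \<subseteq> gm_alphabet M"
  shows "quiet\<^sup>*\<^sup>*
    (config (Forth q (X t)) t0 z (program_tape (P @ P') (int (length P))) (open_stack []))
    (config (Forth q (snd (foldl (exec G) (g, X) P') t)) t0 (z @ moves P')
      (open_program (P @ P')) (open_stack []))"
  using assms(1,3,5,6,7)
proof (induction P' arbitrary: z P g X)
  case Nil
  then show ?case by simp
next
  case (Cons i P')
  obtain g' X' where exec: "exec G (g, X) i = (g', X')" by fastforce
  define w where "w = (case i of Move s \<Rightarrow> Some s | _ \<Rightarrow> None)"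
  define z' where "z' = z @ (case w of None \<Rightarrow> [] | Some s \<Rightarrow> [s])"
  have w: "set_option w \<subseteq> S" using Cons.prems by (auto simp: w_def split: instr.splits)
  have z': "set z' \<subseteq> S" using Cons.prems(1) w by (auto simp: z'_def split: option.splits)
  have at_target: "word_value G z = \<one> \<longleftrightarrow> g = t"
    unfolding Cons.prems(4) using inv_solve_left'[of "\<one>" t g] Cons.prems(3) assms(4) by simp
  have g': "g' \<in> carrier G"
    using exec Cons.prems(2,3) S_carrier by (cases i) auto
  have z'_value: "word_value G z' = inv t \<otimes> g'"
  proof (cases i)
    case (Move s)
    then have "s \<in> carrier G" using Cons.prems(2) S_carrier by auto
    moreover have "set z \<subseteq> carrier G" using Cons.prems(1) S_carrier by blast
    ultimately show ?thesis
      using exec Move Cons.prems(3,4) assms(4) by (auto simp: z'_def w_def m_assoc)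
  qed (use exec Cons.prems(4) in \<open>auto simp: z'_def w_def\<close>)
  have X': "X' t \<subseteq> gm_alphabet M"
    using exec Cons.prems(2,5) by (cases i) (auto split: if_splits)
  have act: "control (word_value G z = \<one>) (Forth q (X t)) a0 (instr_symbol i) a3 =
      Act (Forth q (X' t)) w Stay (instr_symbol i, Move_Right) (a3, Stay)" for a0 a3
    unfolding at_target using exec Cons.prems(2)
    by (cases i) (auto simp: control_def w_def)
  have "quiet\<^sup>+\<^sup>+
    (config (Forth q (X t)) t0 z (program_tape (P @ i # P') (int (length P))) (open_stack []))
    (config (Forth q (X' t)) t0 z' (program_tape (P @ i # P') (int (length P) + 1)) (open_stack []))"
    using config_step[of z "Forth q (X t)" t0 "program_tape (P @ i # P') (int (length P))"
      "open_stack []" "Forth q (X' t)" w Stay "(instr_symbol i, Move_Right)" "(Blank, Stay)"]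
      Cons.prems(1,2,5) assms(2) w X'
    by (simp add: act admissible_def z'_def)
  also have "quiet\<^sup>*\<^sup>* \<dots>
      (config (Forth q (snd (foldl (exec G) (g', X') P') t)) t0 (z' @ moves P')
        (open_program ((P @ [i]) @ P')) (open_stack []))"
    using Cons.IH[of z' g' X' "P @ [i]"] Cons.prems(2) z' g' z'_value X'
    by (simp add: add.commute[of 1])
  also have "z' @ moves P' = z @ moves (i # P')"
    by (cases i) (simp_all add: z'_def w_def)
  finally show ?case by (simp add: exec tranclp_into_rtranclp)
qed

lemma trail_content_in_alphabet:
  "set P \<subseteq> instrs \<Longrightarrow> snd (trail G P) h \<subseteq> gm_alphabet M"
proof (induction P rule: rev_induct)
  case Nil
  then show ?case by (simp add: trail_def)
next
  case (snoc i P)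
  obtain g X where "trail G P = (g, X)" by fastforce
  with snoc show ?case by (cases i) (auto simp: trail_def)
qed

definition main_config ::
    "('g + 'a) tape \<Rightarrow> nat \<Rightarrow> ('g, 'a + nat) instr list \<Rightarrow> 'g list \<Rightarrow> nat \<times> ('g + 'a) tape list" where
  "main_config t0 q P z =
    config (Back q) t0 z (program_tape P (int (length P) - 1)) (open_stack [])"

lemma scan_program:
  assumes "set z \<subseteq> S" "word_value G z = \<one>" "q \<in> gm_states M" "set P \<subseteq> instrs"
  obtains z' where "set z' \<subseteq> S" "word_value G z' = \<one>"
    "quiet\<^sup>*\<^sup>* (main_config t0 q P z)
      (config (Forth q (snd (trail G P) (fst (trail G P)))) t0 z' (open_program P) (open_stack []))"
proof
  \<comment> \<open>\<open>z1\<close> is the oracle word at the turning point between the two passes.\<close>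
  define z1 where "z1 = z @ rev (map (m_inv G) (moves P))"
  let ?t = "fst (trail G P)"
  have moves: "set (moves P) \<subseteq> S" "set (moves P) \<subseteq> carrier G"
    using assms(4) moves_in_S moves_in_carrier by auto
  have t: "?t \<in> carrier G" "?t = word_value G (moves P)"
    using moves by (simp_all add: fst_trail)
  have inv_moves: "set (rev (map (m_inv G) (moves P))) \<subseteq> S" using moves(1) S_inv by auto
  have z1: "set z1 \<subseteq> S" using assms(1) inv_moves by (simp add: z1_def)
  have z1_value: "word_value G z1 = inv ?t"
    unfolding z1_def using assms(1,2) inv_moves S_carrier t moves
    by (subst word_value_append) auto
  show "set (z1 @ moves P) \<subseteq> S" using z1 moves by simp
  show "word_value G (z1 @ moves P) = \<one>"
    using z1 S_carrier moves t z1_value by (subst word_value_append) auto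
  have "quiet\<^sup>*\<^sup>* (main_config t0 q P z)
      (config (Back q) t0 z1 (program_tape P (-1)) (open_stack []))"
    using rewind[OF assms(1,3,4), of t0 "[]"] by (simp add: main_config_def z1_def)
  also have "quiet\<^sup>*\<^sup>* \<dots> (config (Forth q {}) t0 z1 (program_tape P 0) (open_stack []))"
    using config_step[of z1 "Back q" t0 "program_tape P (-1)" "open_stack []"
      "Forth q {}" None Stay "(Blank, Move_Right)" "(Blank, Stay)"] z1 assms(3)
    by (simp add: control_def admissible_def tranclp_into_rtranclp)
  also have "quiet\<^sup>*\<^sup>* \<dots> (config (Forth q (snd (trail G P) ?t)) t0 (z1 @ moves P)
      (open_program P) (open_stack []))"
    using look_up[OF z1 assms(3,4) t(1) one_closed, of "\<lambda>_. {}" t0 "[]"] t z1_value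
    by (simp add: trail_def)
  finally show "quiet\<^sup>*\<^sup>* (main_config t0 q P z)
      (config (Forth q (snd (trail G P) ?t)) t0 (z1 @ moves P) (open_program P) (open_stack []))" .
qed

text \<open>
  The tape of a group machine is centred at its head, the content described by a program at the
  place where the head started; the two differ by a translation by the current position.
\<close>

definition represents :: "('g, 'a + nat) instr list \<Rightarrow> ('g \<Rightarrow> 'a + nat) \<Rightarrow> bool" where
  "represents P x \<longleftrightarrow>
    (\<forall>h \<in> carrier G. x h = symbol_of (gm_blank M) (snd (trail G P) (fst (trail G P) \<otimes> h)))"

lemma represents_step:
  assumes "represents P x" "set P \<subseteq> instrs" "gm_delta M (x \<one>) q = (b, q', s)" "s \<in> S"
  shows "represents (P @ [Write b, Move s]) (fst (gm_step G M (x, q)))"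
proof -
  obtain g X where trail: "trail G P = (g, X)" by fastforce
  then have g: "g \<in> carrier G"
    using fst_trail[of P] moves_in_carrier[OF assms(2)] by simp
  have s: "s \<in> carrier G" using assms(4) S_carrier by auto
  have trail': "trail G (P @ [Write b, Move s]) = (g \<otimes> s, X(g := {b}))"
    using trail by (simp add: trail_def)
  have "fst (gm_step G M (x, q)) h =
      symbol_of (gm_blank M) ((X(g := {b})) (g \<otimes> s \<otimes> h))" if h: "h \<in> carrier G" for h
  proof -
    \<comment> \<open>The cell just written is seen after the move exactly at the place \<open>h\<close> with \<open>s h = \<one>\<close>.\<close>
    have "g \<otimes> s \<otimes> h = g \<longleftrightarrow> s \<otimes> h = \<one>"
      using g s h r_cancel_one'[of "s \<otimes> h" g] l_cancel_one[of g "s \<otimes> h"] by (auto simp: m_assoc)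
    moreover have "fst (gm_step G M (x, q)) h = (x(\<one> := b)) (s \<otimes> h)"
      using assms(3) s h by (simp add: shift_def)
    ultimately show ?thesis
      using assms(1) g s h by (simp add: represents_def trail m_assoc)
  qed
  then show ?thesis by (simp add: represents_def trail')
qed

text \<open>
  The oracle word is left unspecified up to its value in the group: it grows with every pass and
  records no information beyond that value.
\<close>

definition simulates :: "('g + 'a) tape \<Rightarrow> ('g \<Rightarrow> 'a + nat) \<times> nat \<Rightarrow> nat \<times> ('g + 'a) tape list \<Rightarrow> bool" where
  "simulates t0 xq c \<longleftrightarrow> (\<exists>P z. set P \<subseteq> instrs \<and> snd xq \<in> gm_states M \<and> set z \<subseteq> S \<and>
     word_value G z = \<one> \<and> represents P (fst xq) \<and> c = main_config t0 (snd xq) P z)"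

lemma represented_origin:
  assumes "set P \<subseteq> instrs" "represents P x"
  shows "x \<one> = symbol_of (gm_blank M) (snd (trail G P) (fst (trail G P)))"
  using assms moves_in_carrier by (simp add: represents_def fst_trail)

lemma simulates_accept:
  assumes "simulates t0 (x, q) c" "q \<in> gm_accepting M"
  shows "accepting_run WP simulator c"
proof -
  obtain P z where c: "set P \<subseteq> instrs" "q \<in> gm_states M" "set z \<subseteq> S" "word_value G z = \<one>"
    "c = main_config t0 q P z"
    using assms(1) by (auto simp: simulates_def)
  let ?B = "snd (trail G P) (fst (trail G P))"
  obtain z' where z': "set z' \<subseteq> S"
    "quiet\<^sup>*\<^sup>* c (config (Forth q ?B) t0 z' (open_program P) (open_stack []))"
    using scan_program[OF c(3,4,2,1), of t0] c(5) by metis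
  have "accepting_run WP simulator (config (Forth q ?B) t0 z' (open_program P) (open_stack []))"
    using assms(2) c(1,2) z'(1) trail_content_in_alphabet
    by (intro config_accept) (simp_all add: control_def)
  then show ?thesis by (simp add: accepting_run_quiet_steps[OF z'(2)])
qed

lemma simulates_step:
  assumes "simulates t0 (x, q) c" "q \<notin> gm_accepting M"
  shows "\<exists>c'. simulates t0 (gm_step G M (x, q)) c' \<and> quiet\<^sup>+\<^sup>+ c c'"
proof -
  obtain P z where c: "set P \<subseteq> instrs" "q \<in> gm_states M" "set z \<subseteq> S" "word_value G z = \<one>"
    "represents P x" "c = main_config t0 q P z"
    using assms(1) by (auto simp: simulates_def)
  let ?B = "snd (trail G P) (fst (trail G P))"
  have B: "?B \<subseteq> gm_alphabet M" by (rule trail_content_in_alphabet[OF c(1)])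
  have x: "x \<one> = symbol_of (gm_blank M) ?B" by (rule represented_origin[OF c(1,5)])
  obtain b q' s where d: "gm_delta M (x \<one>) q = (b, q', s)" using prod_cases3 by blast
  have closed: "b \<in> gm_alphabet M" "q' \<in> gm_states M" "s \<in> S"
    using delta_closed[OF _ c(2) d] x symbol_of_in[OF machine_facts(3) B] by simp_all
  obtain z' where z': "set z' \<subseteq> S" "word_value G z' = \<one>"
    "quiet\<^sup>*\<^sup>* c (config (Forth q ?B) t0 z' (open_program P) (open_stack []))"
    using scan_program[OF c(3,4,2,1), of t0] c(6) by metis
  note z'(3)
  also have "quiet\<^sup>+\<^sup>+ (config (Forth q ?B) t0 z' (open_program P) (open_stack []))
      (config (Emit q' s) t0 z' (open_program (P @ [Write b])) (open_stack []))"
    using config_step[of z' "Forth q ?B" t0 "open_program P" "open_stack []"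
      "Emit q' s" None Stay "(instr_symbol (Write b), Move_Right)" "(Blank, Stay)"]
      z'(1) c(2) B closed assms(2) d x
    by (simp add: control_def admissible_def)
  also have "quiet\<^sup>+\<^sup>+ \<dots> (main_config t0 q' (P @ [Write b, Move s]) z')"
    using config_step[of z' "Emit q' s" t0 "open_program (P @ [Write b])" "open_stack []"
      "Back q'" None Stay "(instr_symbol (Move s), Stay)" "(Blank, Stay)"]
      write_move_program_tape(2)[of "Move s" "P @ [Write b]"] z'(1) closed
    by (simp add: control_def admissible_def main_config_def)
  finally have "quiet\<^sup>+\<^sup>+ c (main_config t0 q' (P @ [Write b, Move s]) z')" .
  moreover have "simulates t0 (gm_step G M (x, q)) (main_config t0 q' (P @ [Write b, Move s]) z')"
    using represents_step[OF c(5,1) d closed(3)] c(1) closed z' d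
    by (auto simp: simulates_def intro!: exI[of _ "P @ [Write b, Move s]"] exI[of _ z'])
  ultimately show ?thesis by blast
qed

lemma accepting_run_simulates:
  assumes "simulates t0 xq c"
  shows "accepting_run WP simulator c \<longleftrightarrow>
    (\<exists>n. snd ((gm_step G M ^^ n) xq) \<in> gm_accepting M)"
proof
  assume "\<exists>n. snd ((gm_step G M ^^ n) xq) \<in> gm_accepting M"
  then obtain n where "snd ((gm_step G M ^^ n) xq) \<in> gm_accepting M" by blast
  then show "accepting_run WP simulator c" using assms
  proof (induction n arbitrary: xq c)
    case 0
    then show ?case using simulates_accept[of t0 "fst xq" "snd xq"] by simp
  next
    case (Suc n)
    show ?case
    proof (cases "snd xq \<in> gm_accepting M")
      case True
      then show ?thesis using simulates_accept[of t0 "fst xq" "snd xq"] Suc.prems(2) by simp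
    next
      case False
      then obtain c' where c': "simulates t0 (gm_step G M xq) c'" "quiet\<^sup>+\<^sup>+ c c'"
        using simulates_step[of t0 "fst xq" "snd xq" c] Suc.prems(2) unfolding prod.collapse by blast
      have "accepting_run WP simulator c'"
        using Suc.prems(1) c'(1) by (intro Suc.IH[of "gm_step G M xq"])
          (simp_all add: funpow_Suc_right del: funpow.simps)
      then show ?thesis
        by (simp add: accepting_run_quiet_steps[OF tranclp_into_rtranclp[OF c'(2)]])
    qed
  qed
next
  define I where
    "I = {c. \<exists>yq. simulates t0 yq c \<and> (\<forall>n. snd ((gm_step G M ^^ n) yq) \<notin> gm_accepting M)}"
  have "\<exists>c' \<in> I. quiet\<^sup>+\<^sup>+ c c'" if in_I: "c \<in> I" for c
  proof -
    obtain yq where yq: "simulates t0 yq c"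
      and never: "\<forall>n. snd ((gm_step G M ^^ n) yq) \<notin> gm_accepting M"
      using in_I unfolding I_def by blast
    have "snd yq \<notin> gm_accepting M" using never[THEN spec, of 0] by simp
    then obtain c' where c': "simulates t0 (gm_step G M yq) c'" "quiet\<^sup>+\<^sup>+ c c'"
      using simulates_step[of t0 "fst yq" "snd yq" c] yq unfolding prod.collapse by blast
    moreover have "snd ((gm_step G M ^^ n) (gm_step G M yq)) \<notin> gm_accepting M" for n
      using never[THEN spec, of "Suc n"] by (simp add: funpow_Suc_right del: funpow.simps)
    ultimately show ?thesis unfolding I_def by blast
  qed
  then have "c \<in> I \<Longrightarrow> \<not> accepting_run WP simulator c"
    by (rule no_accepting_run_if_recurrent)
  moreover assume "accepting_run WP simulator c"
  ultimately show "\<exists>n. snd ((gm_step G M ^^ n) xq) \<in> gm_accepting M"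
    using assms unfolding I_def by blast
qed


section \<open>The set of accepted codings\<close>

text \<open>
  The initial tape for an arbitrary coding; it depends on the set of pairs only.
\<close>

definition coding_fill :: "('g list \<times> 'a) set \<Rightarrow> 'g \<Rightarrow> 'a + nat" where
  "coding_fill c = (\<lambda>h \<in> carrier G. symbol_of (gm_blank M) (coding_content G c h))"

definition accepted_codings :: "('g list \<times> 'a) set set" where
  "accepted_codings = {c \<in> pattern_codings S A.
     \<exists>n. snd ((gm_step G M ^^ n) (coding_fill c, gm_init M)) \<in> gm_accepting M}"

lemma listing_program_instrs:
  assumes "set cs \<subseteq> lists S \<times> A"
  shows "set (listing_program G cs) \<subseteq> instrs"
  using assms A_alphabet S_inv
  by (fastforce simp: listing_program_def pair_program_def in_lists_conv_set)

lemma accepts_listing_iff: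
  assumes "set cs \<subseteq> lists S \<times> A"
  shows "tm_accepts WP simulator (encode_listing cs) \<longleftrightarrow> set cs \<in> accepted_codings"
proof -
  let ?P = "listing_program G cs" and ?t0 = "input_tape (encode_listing cs) []"
  have trail: "trail G ?P = (\<one>, coding_content G (set cs))"
    using assms S_carrier by (intro trail_listing_program) fastforce
  have "represents ?P (coding_fill (set cs))"
    by (simp add: represents_def trail coding_fill_def)
  then have sim: "simulates ?t0 (coding_fill (set cs), gm_init M)
      (main_config ?t0 (gm_init M) ?P [])"
    using listing_program_instrs[OF assms] machine_facts(4) unfolding simulates_def
    by (intro exI[of _ ?P] exI[of _ "[]"]) simp
  have "quiet\<^sup>+\<^sup>+ (config (Read True) ?t0 [] (open_program ?P) (open_stack []))
      (main_config ?t0 (gm_init M) ?P [])"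
    using config_step[of "[]" "Read True" ?t0 "open_program ?P" "open_stack []"
      "Back (gm_init M)" None Stay "(Blank, Move_Left)" "(Blank, Stay)"] machine_facts(4)
    by (simp add: control_def admissible_def main_config_def)
  from accepting_run_quiet_steps[OF tranclp_into_rtranclp[OF this]]
  have "tm_accepts WP simulator (encode_listing cs) \<longleftrightarrow>
      accepting_run WP simulator (main_config ?t0 (gm_init M) ?P [])"
    using tm_accepts_listing[OF assms, of "[]"] by simp
  also have "\<dots> \<longleftrightarrow> set cs \<in> accepted_codings"
    using assms by (simp add: accepting_run_simulates[OF sim] accepted_codings_def
        pattern_codings_def)
  finally show ?thesis .
qed

lemma accepted_codings_re: "codings_re_with_oracle_WP G S A accepted_codings"
proof -
  have "{x \<in> lists (S <+> A). tm_accepts WP simulator x} =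
      {encode_listing cs |cs. set cs \<in> accepted_codings}"
  proof (intro equalityI subsetI; elim CollectE conjE exE)
    fix x assume x: "x \<in> lists (S <+> A)" "tm_accepts WP simulator x"
    obtain cs w where cs: "set cs \<subseteq> lists S \<times> A" "set w \<subseteq> S" "x = encode_listing cs @ map Inl w"
      using listing_decomposition[OF x(1)] by blast
    with x rejects_dangling_word have "w = []" by blast
    with cs x accepts_listing_iff
    show "x \<in> {encode_listing cs |cs. set cs \<in> accepted_codings}" by auto
  next
    fix x cs assume x: "x = encode_listing cs" "set cs \<in> accepted_codings"
    then have cs: "set cs \<subseteq> lists S \<times> A"
      by (auto simp: accepted_codings_def pattern_codings_def)
    then have "x \<in> lists (S <+> A)"
      by (fastforce simp: x encode_listing_def in_lists_conv_set)
    with x cs accepts_listing_iff show "x \<in> {x \<in> lists (S <+> A). tm_accepts WP simulator x}"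
      by simp
  qed
  then show ?thesis
    using is_oracle_tm_simulator
    unfolding codings_re_with_oracle_WP_def recursively_enumerable_in_def by blast
qed

lemma coding_fill_consistent:
  assumes "consistent G c"
  shows "coding_fill c = gm_fill G M (map_option Inl \<circ> coded_pattern G c)"
proof
  fix h
  show "coding_fill c h = gm_fill G M (map_option Inl \<circ> coded_pattern G c) h"
  proof (cases "\<exists>w a. (w, a) \<in> c \<and> word_value G w = h")
    case True
    then obtain w a where wa: "(w, a) \<in> c" "word_value G w = h" by blast
    have only: "(\<exists>w. (w, b) \<in> c \<and> word_value G w = h) \<longleftrightarrow> b = a" for b
      using assms wa unfolding consistent_def by blast
    then have "coding_content G c h = {Inl a}" by (auto simp: coding_content_def)
    moreover have "coded_pattern G c h = Some a"
      using True by (simp add: coded_pattern_def only)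
    ultimately show ?thesis by (simp add: coding_fill_def gm_fill_def restrict_def)
  next
    case False
    then have "coding_content G c h = {}" "coded_pattern G c h = None"
      by (auto simp: coding_content_def coded_pattern_def)
    then show ?thesis by (simp add: coding_fill_def gm_fill_def restrict_def)
  qed
qed

end

lemma (in group) coded_pattern_in_patterns:
  assumes "c \<in> pattern_codings S A" "S \<subseteq> carrier G" "consistent G c"
  shows "coded_pattern G c \<in> patterns G A"
proof -
  have c: "finite c" "c \<subseteq> lists S \<times> A" using assms(1) by (auto simp: pattern_codings_def)
  have dom: "dom (coded_pattern G c) = (\<lambda>(w, a). word_value G w) ` c"
    by (force simp: coded_pattern_def dom_def split: if_splits)
  have "ran (coded_pattern G c) \<subseteq> A"
  proof
    fix a assume "a \<in> ran (coded_pattern G c)"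
    then obtain h where h: "coded_pattern G c h = Some a" by (auto simp: ran_def)
    then obtain w b where wb: "(w, b) \<in> c" "word_value G w = h"
      by (auto simp: coded_pattern_def split: if_splits)
    have "(THE b. \<exists>w. (w, b) \<in> c \<and> word_value G w = h) = b"
      using assms(3) wb unfolding consistent_def by (intro the_equality) blast+
    with h wb c show "a \<in> A" by (auto simp: coded_pattern_def split: if_splits)
  qed
  moreover have "dom (coded_pattern G c) \<subseteq> carrier G"
  proof -
    have "word_value G w \<in> carrier G" if "(w, a) \<in> c" for w a
    proof (rule word_value_closed)
      have "w \<in> lists S" using c(2) that by blast
      then show "set w \<subseteq> carrier G" using assms(2) by (auto simp: lists_eq_set)
    qed
    then show ?thesis unfolding dom by auto
  qed
  ultimately show ?thesis using c by (simp add: patterns_def dom)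
qed

lemma (in group) pattern_has_coding:
  assumes "p \<in> patterns G A" "S \<subseteq> carrier G" "\<And>s. s \<in> S \<Longrightarrow> inv s \<in> S"
    "generate G S = carrier G"
  obtains c where "c \<in> pattern_codings S A" "consistent G c" "coded_pattern G c = p"
proof -
  have "\<forall>g \<in> carrier G. \<exists>w. w \<in> lists S \<and> word_value G w = g"
    using word_for_generated[OF assms(2,3)] assms(4) by blast
  then obtain f where f: "\<And>g. g \<in> carrier G \<Longrightarrow> f g \<in> lists S \<and> word_value G (f g) = g"
    by metis
  have p: "finite (dom p)" "dom p \<subseteq> carrier G" "ran p \<subseteq> A" using assms(1) by (auto simp: patterns_def)
  define c where "c = (\<lambda>g. (f g, the (p g))) ` dom p"
  have c: "(w, a) \<in> c \<and> word_value G w = g \<longleftrightarrow> w = f g \<and> p g = Some a" for w a g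
  proof
    assume "(w, a) \<in> c \<and> word_value G w = g"
    then obtain h where h: "h \<in> dom p" "w = f h" "a = the (p h)" "word_value G w = g"
      unfolding c_def by blast
    then have "h = g" using f[of h] p(2) by auto
    with h show "w = f g \<and> p g = Some a" by auto
  next
    assume w: "w = f g \<and> p g = Some a"
    then have "g \<in> dom p" by blast
    then have "(f g, the (p g)) \<in> c" "g \<in> carrier G" using p(2) by (auto simp: c_def)
    with w f[of g] show "(w, a) \<in> c \<and> word_value G w = g" by simp
  qed
  show ?thesis
  proof
    have "f g \<in> lists S \<and> the (p g) \<in> A" if "g \<in> dom p" for g
      using that f[of g] p(2,3) by (auto intro: ranI)
    then have "c \<subseteq> lists S \<times> A" by (auto simp: c_def simp del: in_lists_conv_set)
    then show "c \<in> pattern_codings S A" using p by (simp add: pattern_codings_def c_def)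
    show "consistent G c" unfolding consistent_def
    proof (intro allI impI)
      fix u a v b
      assume "(u, a) \<in> c" "(v, b) \<in> c" "word_value G u = word_value G v"
      then show "a = b"
        using c[of u a "word_value G u"] c[of v b "word_value G u"] by simp
    qed
    show "coded_pattern G c = p"
    proof
      fix g
      show "coded_pattern G c g = p g"
        by (cases "p g") (simp_all add: coded_pattern_def c)
    qed
  qed
qed

theorem theorem3p3:
  fixes G :: "('g, 'b) monoid_scheme"
    and S :: "'g set"
    and A :: "'a set"
    and L :: "('g \<rightharpoonup> 'a) set"
  assumes "group G"
    and "finite S" and "S \<subseteq> carrier G" and "generate G S = carrier G"
    and "\<one>\<^bsub>G\<^esub> \<in> S" and "\<And>s. s \<in> S \<Longrightarrow> inv\<^bsub>G\<^esub> s \<in> S"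
    and "finite A"
    and "g_recursively_enumerable G S A L"
  shows "\<exists>C \<subseteq> pattern_codings S A.
           codings_re_with_oracle_WP G S A C \<and> L = coded_patterns G C"
proof -
  interpret group G by fact
  obtain M :: "('g, 'a + nat, nat) g_machine" where L: "L \<subseteq> patterns G A"
    and M: "is_g_machine S M" "Inl ` A \<subseteq> gm_alphabet M"
    and L_iff: "\<And>p. p \<in> patterns G A \<Longrightarrow> gm_accepts G M (map_option Inl \<circ> p) \<longleftrightarrow> p \<in> L"
    using assms(8) unfolding g_recursively_enumerable_def by blast
  interpret machine_simulation G S A M
    using assms M by unfold_locales auto
  have accepted_iff: "c \<in> accepted_codings \<longleftrightarrow> coded_pattern G c \<in> L"
    if c: "c \<in> pattern_codings S A" "consistent G c" for c
    using c L_iff[OF coded_pattern_in_patterns[OF c(1) assms(3) c(2)]]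
    by (simp add: accepted_codings_def coding_fill_consistent gm_accepts_def)
  have sub: "accepted_codings \<subseteq> pattern_codings S A" by (auto simp: accepted_codings_def)
  have "coded_patterns G accepted_codings = L"
  proof (intro equalityI subsetI)
    fix p assume "p \<in> coded_patterns G accepted_codings"
    then show "p \<in> L" using accepted_iff sub by (auto simp: coded_patterns_def)
  next
    fix p assume "p \<in> L"
    then obtain c where "c \<in> pattern_codings S A" "consistent G c" "coded_pattern G c = p"
      using pattern_has_coding[OF _ assms(3,6,4)] L by blast
    with \<open>p \<in> L\<close> accepted_iff show "p \<in> coded_patterns G accepted_codings"
      by (auto simp: coded_patterns_def)
  qed
  with sub accepted_codings_re show ?thesis by blast
qed

end
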